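(* Let $h>0$, let $k,w\in C^2[0,h]$ with $k(z)>0$ for all $z\in[0,h]$ and $w(0)=w(h)=0$, and let $\epsilon>0$ be such that $k(z)\ge \epsilon$ for all $z\in[0,h]$. There exists a positive constant $K$, depending on $\sup|w|$, $k(0)$, $\epsilon$ and $h$, such that if $T>0$, $F\in C[0,T]$ and $q_0\in C^1[0,h]$, then $$\|q^F(\cdot,t)\|_{L^2(0,h)}^2\le K e^{Kt}\left[(1+t)\|q_0\|_{L^2(0,h)}^2+(1+t^2)\|F\|_{L^2(0,t)}^2\right]$$ for every $t\in[0,T]$, where $q^F$ denotes the unique solution on $[0,h]\times(0,T]$ of $q_t+(wq)_z=(kq_z)_z$ with boundary conditions $q_z(0,t)=-F(t)$, $q_z(h,t)=0$ and initial condition $q(z,0)=q_0(z)$.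
   Context: Subscripts $z,t$ denote partial derivatives. It is a standard fact that for $k,w\in C^2[0,h]$ with $k>0$ on $[0,h]$, $F\in C[0,T]$ and $q_0\in C^1[0,h]$, the stated initial-boundary value problem has a unique (classical) solution; this solution is denoted $q^F$. The constant $K$ does not depend on $T$, $F$, $q_0$ or $t$. *)

theory Defs
  imports "HOL-Analysis.Analysis"
begin

text \<open>Derivatives are taken within \<open>S\<close>, so for \<open>S = {a..b}\<close> they are one-sided at the
  end points, and values of the function outside \<open>S\<close> are irrelevant.\<close>

primrec Cn_on :: "nat \<Rightarrow> real set \<Rightarrow> (real \<Rightarrow> real) \<Rightarrow> bool" where
  "Cn_on 0 S f \<longleftrightarrow> continuous_on S f"
| "Cn_on (Suc n) S f \<longleftrightarrow>
     (\<exists>f'. (\<forall>x\<in>S. (f has_real_derivative f' x) (at x within S)) \<and> Cn_on n S f')"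

definition L2_norm :: "real \<Rightarrow> real \<Rightarrow> (real \<Rightarrow> real) \<Rightarrow> real" where
  "L2_norm a b f = sqrt (LINT x:{a<..<b}|lborel. (f x)\<^sup>2)"

text \<open>Classical solutions \<open>q z t\<close> of \<open>q_t + (w q)_z = (k q_z)_z\<close> with Neumann data
  \<open>q_z(0,t) = -F(t)\<close>, \<open>q_z(h,t) = 0\<close> and initial value \<open>q0\<close>: \<open>q\<close> is continuous up to
  \<open>t = 0\<close>, \<open>q_z\<close> is continuous up to the lateral boundary for \<open>t > 0\<close>, and the equation holds
  in \<open>(0,h) \<times> (0,T]\<close>. Since \<open>F\<close> is merely continuous and no compatibility between \<open>q0\<close> and
  the boundary data is imposed, \<open>q_t\<close> and \<open>q_zz\<close> need not exist at \<open>z = 0\<close>, nor need \<open>q_z\<close>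
  be continuous at \<open>t = 0\<close>.\<close>

definition classical_solution ::
  "real \<Rightarrow> (real \<Rightarrow> real) \<Rightarrow> (real \<Rightarrow> real) \<Rightarrow> real \<Rightarrow> (real \<Rightarrow> real) \<Rightarrow> (real \<Rightarrow> real)
    \<Rightarrow> (real \<Rightarrow> real \<Rightarrow> real) \<Rightarrow> bool" where
  "classical_solution h k w T F q0 q \<longleftrightarrow>
     continuous_on ({0..h} \<times> {0..T}) (\<lambda>(z, t). q z t) \<and>
     (\<forall>z\<in>{0..h}. q z 0 = q0 z) \<and>
     (\<exists>qz qzz qt.
        (\<forall>z\<in>{0..h}. \<forall>t\<in>{0<..T}. ((\<lambda>y. q y t) has_real_derivative qz z t) (at z within {0..h})) \<and>
        continuous_on ({0..h} \<times> {0<..T}) (\<lambda>(z, t). qz z t) \<and>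
        (\<forall>z\<in>{0<..<h}. \<forall>t\<in>{0<..T}. ((\<lambda>y. qz y t) has_real_derivative qzz z t) (at z)) \<and>
        continuous_on ({0<..<h} \<times> {0<..T}) (\<lambda>(z, t). qzz z t) \<and>
        (\<forall>z\<in>{0<..<h}. \<forall>t\<in>{0<..T}. ((\<lambda>s. q z s) has_real_derivative qt z t) (at t within {0..T})) \<and>
        continuous_on ({0<..<h} \<times> {0<..T}) (\<lambda>(z, t). qt z t) \<and>
        (\<forall>z\<in>{0<..<h}. \<forall>t\<in>{0<..T}.
           qt z t + deriv (\<lambda>y. w y * q y t) z = deriv (\<lambda>y. k y * qz y t) z) \<and>
        (\<forall>t\<in>{0<..T}. qz 0 t = - F t \<and> qz h t = 0))"

end

theory Submission
  imports Defs
begin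

text \<open>The energy \<open>E t = \<integral> q\<^sup>2 dz\<close> satisfies
  \<open>E' = 2 k(0) F q(0,\<cdot>) - 2 \<integral> q\<^sub>z (k q\<^sub>z - w q) dz\<close>. Because the second order derivatives are only
  available in the interior, this is first shown on \<open>[a, b]\<close> with \<open>0 < a < b < h\<close>, where it
  contains flux terms at \<open>a\<close> and \<open>b\<close>; it passes to the limit because the derivatives of the
  truncated energies converge locally uniformly in time. The boundary value is absorbed with
  \<open>h q(0)\<^sup>2 = \<integral> (q\<^sup>2 - 2 (h - z) q q\<^sub>z) dz\<close>, which gives \<open>E' \<le> C E + D F\<^sup>2\<close>, and Gronwall's
  argument concludes.\<close>

section \<open>Uniform limits in the time parameter\<close>

lemma continuous_on_slice_fst:
  fixes f :: "'a::topological_space \<Rightarrow> 'b::topological_space \<Rightarrow> 'c::topological_space"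
  assumes "continuous_on (A \<times> B) (\<lambda>(z, t). f z t)" "A' \<subseteq> A" "t \<in> B"
  shows "continuous_on A' (\<lambda>z. f z t)"
  by (rule continuous_on_compose2[OF assms(1), of A' "\<lambda>z. (z, t)", simplified])
     (use assms in \<open>auto intro!: continuous_intros\<close>)

text \<open>Termwise differentiation: \<open>has_derivative_sequence\<close> supplies some pointwise
  limit \<open>G\<close> with derivative \<open>g'\<close>, and uniqueness of limits identifies
  \<open>G\<close> with \<open>g\<close> on \<open>S\<close>.\<close>

lemma has_real_derivative_uniform_limit:
  fixes f f' :: "nat \<Rightarrow> real \<Rightarrow> real"
  assumes S: "convex S"
    and df: "\<And>n x. x \<in> S \<Longrightarrow> (f n has_real_derivative f' n x) (at x within S)"
    and lim': "uniform_limit S f' g' sequentially"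
    and lim: "\<And>x. x \<in> S \<Longrightarrow> (\<lambda>n. f n x) \<longlonglongrightarrow> g x"
    and x: "x \<in> S"
  shows "(g has_real_derivative g' x) (at x within S)"
proof -
  have "\<exists>G. \<forall>y\<in>S. (\<lambda>n. f n y) \<longlonglongrightarrow> G y \<and> (G has_derivative ((*) (g' y))) (at y within S)"
  proof (rule has_derivative_sequence[where f = f and f' = "\<lambda>n y. (*) (f' n y)"
        and g' = "\<lambda>y. (*) (g' y)", OF S _ _ x lim[OF x]])
    show "(f n has_derivative (*) (f' n y)) (at y within S)" if "y \<in> S" for n y
      using df[OF that] by (simp add: has_field_derivative_def)
    show "\<forall>\<^sub>F n in sequentially. \<forall>y\<in>S. \<forall>d. norm (f' n y * d - g' y * d) \<le> e * norm d"
      if "e > 0" for e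
      using uniform_limitD[OF lim' that]
      by eventually_elim
         (auto simp: dist_real_def abs_mult left_diff_distrib[symmetric] intro!: mult_right_mono
            intro: less_imp_le)
  qed
  then obtain G where G: "\<And>y. y \<in> S \<Longrightarrow> (\<lambda>n. f n y) \<longlonglongrightarrow> G y"
      "\<And>y. y \<in> S \<Longrightarrow> (G has_derivative ((*) (g' y))) (at y within S)"
    by blast
  have "g y = G y" if "y \<in> S" for y
    using LIMSEQ_unique[OF lim[OF that] G(1)[OF that]] .
  then show ?thesis
    unfolding has_field_derivative_def by (rule has_derivative_transform[OF x _ G(2)[OF x]])
qed

text \<open>By Heine-Cantor on the compact product, the distance from \<open>a n\<close> to
  \<open>l\<close> alone controls the difference, with one modulus for all \<open>t\<close>. This
  handles the flux terms at the moving cut points.\<close>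

lemma uniform_limit_slice:
  fixes f :: "real \<Rightarrow> real \<Rightarrow> real"
  assumes cont: "continuous_on (A \<times> S) (\<lambda>(z, t). f z t)" and "compact A" "compact S"
    and a: "a \<longlonglongrightarrow> l" "\<And>n. a n \<in> A" "l \<in> A"
  shows "uniform_limit S (\<lambda>n t. f (a n) t) (f l) sequentially"
proof (rule uniform_limitI)
  fix e :: real assume "e > 0"
  have "uniformly_continuous_on (A \<times> S) (\<lambda>(z, t). f z t)"
    using assms by (intro compact_uniformly_continuous compact_Times)
  then obtain d where d: "d > 0" "\<And>x x'. x \<in> A \<times> S \<Longrightarrow> x' \<in> A \<times> S \<Longrightarrow> dist x' x < d \<Longrightarrow>
      dist (case x' of (z, t) \<Rightarrow> f z t) (case x of (z, t) \<Rightarrow> f z t) < e"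
    unfolding uniformly_continuous_on_def using \<open>e > 0\<close> by blast
  from tendstoD[OF a(1) d(1)] show "\<forall>\<^sub>F n in sequentially. \<forall>t\<in>S. dist (f (a n) t) (f l t) < e"
  proof eventually_elim
    case (elim n)
    show ?case
    proof
      fix t assume "t \<in> S"
      then show "dist (f (a n) t) (f l t) < e"
        using d(2)[of "(l, t)" "(a n, t)"] elim a by (simp add: dist_Pair_Pair)
    qed
  qed
qed

text \<open>A bound \<open>M\<close> for the integrand on the compact rectangle bounds the two
  omitted end pieces by \<open>M\<close> times their lengths, independently of
  \<open>t\<close>.\<close>

lemma uniform_limit_shrinking_integral:
  fixes f :: "real \<Rightarrow> real \<Rightarrow> real"
  assumes cont: "continuous_on ({l..r} \<times> S) (\<lambda>(z, t). f z t)" and S: "compact S"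
    and a: "a \<longlonglongrightarrow> l" and b: "b \<longlonglongrightarrow> r"
    and ab: "\<And>n. l \<le> a n" "\<And>n. a n \<le> b n" "\<And>n. b n \<le> r"
  shows "uniform_limit S (\<lambda>n t. integral {a n..b n} (\<lambda>z. f z t)) (\<lambda>t. integral {l..r} (\<lambda>z. f z t))
    sequentially"
proof (rule uniform_limitI)
  fix e :: real assume "e > 0"
  have "bounded ((\<lambda>(z, t). f z t) ` ({l..r} \<times> S))"
    using assms by (intro compact_imp_bounded compact_continuous_image compact_Times) auto
  then obtain M where M: "M > 0" "\<And>z t. z \<in> {l..r} \<Longrightarrow> t \<in> S \<Longrightarrow> norm (f z t) \<le> M"
    unfolding bounded_pos by force
  have "(\<lambda>n. M * (a n - l) + M * (r - b n)) \<longlonglongrightarrow> M * (l - l) + M * (r - r)"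
    by (intro tendsto_intros a b)
  then have "\<forall>\<^sub>F n in sequentially. M * (a n - l) + M * (r - b n) < e"
    using \<open>e > 0\<close> by (intro order_tendstoD) auto
  then show "\<forall>\<^sub>F n in sequentially. \<forall>t\<in>S.
      dist (integral {a n..b n} (\<lambda>z. f z t)) (integral {l..r} (\<lambda>z. f z t)) < e"
  proof eventually_elim
    case (elim n)
    show ?case
    proof
      fix t assume t: "t \<in> S"
      let ?I = "\<lambda>x y. integral {x..y} (\<lambda>z. f z t)"
      have c: "continuous_on {x..y} (\<lambda>z. f z t)" if "l \<le> x" "y \<le> r" for x y
        using continuous_on_slice_fst[OF cont _ t] that by auto
      have "?I l (a n) + ?I (a n) r = ?I l r" "?I (a n) (b n) + ?I (b n) r = ?I (a n) r"
        using ab[of n] c by (auto intro!: Henstock_Kurzweil_Integration.integral_combine integrable_continuous_real)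
      moreover have "norm (?I l (a n)) \<le> M * (a n - l)" "norm (?I (b n) r) \<le> M * (r - b n)"
        by (rule integral_bound; use ab[of n] c M(2) t in force)+
      ultimately show "dist (?I (a n) (b n)) (?I l r) < e"
        using elim unfolding dist_real_def real_norm_def by linarith
    qed
  qed
qed

section \<open>The energy identity\<close>

text \<open>Here \<open>v\<close> stands for the space derivative of \<open>q\<close> and
  \<open>\<phi>\<close> for the flux; the assumption that \<open>\<phi>\<close> has space derivative
  \<open>qt\<close> is the differential equation. With everything continuous on the closed
  rectangle, one differentiates under the integral and integrates \<open>q * qt\<close> by
  parts.\<close>

lemma energy_identity_interior:
  fixes q v \<phi> qt :: "real \<Rightarrow> real \<Rightarrow> real"
  assumes "a \<le> b"
    and q: "continuous_on ({a..b} \<times> {s..T}) (\<lambda>(z, t). q z t)"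
    and v: "continuous_on ({a..b} \<times> {s..T}) (\<lambda>(z, t). v z t)"
    and \<phi>: "continuous_on ({a..b} \<times> {s..T}) (\<lambda>(z, t). \<phi> z t)"
    and qt: "continuous_on ({a..b} \<times> {s..T}) (\<lambda>(z, t). qt z t)"
    and dqz: "\<And>z t. z \<in> {a..b} \<Longrightarrow> t \<in> {s..T} \<Longrightarrow>
      ((\<lambda>y. q y t) has_real_derivative v z t) (at z within {a..b})"
    and d\<phi>: "\<And>z t. z \<in> {a..b} \<Longrightarrow> t \<in> {s..T} \<Longrightarrow>
      ((\<lambda>y. \<phi> y t) has_real_derivative qt z t) (at z within {a..b})"
    and dqt: "\<And>z t. z \<in> {a..b} \<Longrightarrow> t \<in> {s..T} \<Longrightarrow>
      ((\<lambda>u. q z u) has_real_derivative qt z t) (at t within {s..T})"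
    and t: "t \<in> {s..T}"
  shows "((\<lambda>t. integral {a..b} (\<lambda>z. (q z t)\<^sup>2)) has_real_derivative
    2 * (q b t * \<phi> b t - q a t * \<phi> a t - integral {a..b} (\<lambda>z. v z t * \<phi> z t))) (at t within {s..T})"
proof -
  \<comment> \<open>Integration by parts, as the fundamental theorem for the product of
    \<open>q\<close> and \<open>\<phi>\<close>.\<close>
  have "((\<lambda>z. v z t * \<phi> z t + q z t * qt z t) has_integral (q b t * \<phi> b t - q a t * \<phi> a t)) {a..b}"
    using dqz[OF _ t] d\<phi>[OF _ t]
    by (intro fundamental_theorem_of_calculus \<open>a \<le> b\<close>)
       (auto intro!: derivative_eq_intros simp: has_real_derivative_iff_has_vector_derivative[symmetric])
  moreover have "((\<lambda>z. v z t * \<phi> z t) has_integral integral {a..b} (\<lambda>z. v z t * \<phi> z t)) {a..b}"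
    by (intro integrable_integral integrable_continuous_real continuous_intros
        continuous_on_slice_fst[OF v _ t] continuous_on_slice_fst[OF \<phi> _ t]) auto
  ultimately have "((\<lambda>z. 2 * ((v z t * \<phi> z t + q z t * qt z t) - v z t * \<phi> z t)) has_integral
      2 * (q b t * \<phi> b t - q a t * \<phi> a t - integral {a..b} (\<lambda>z. v z t * \<phi> z t))) {a..b}"
    by (intro has_integral_mult_right has_integral_diff)
  then have eq: "integral {a..b} (\<lambda>z. 2 * q z t * qt z t) =
      2 * (q b t * \<phi> b t - q a t * \<phi> a t - integral {a..b} (\<lambda>z. v z t * \<phi> z t))"
    by (intro integral_unique) (simp add: mult.assoc)
  have "((\<lambda>t. integral (cbox a b) (\<lambda>z. (q z t)\<^sup>2)) has_real_derivative
      integral (cbox a b) (\<lambda>z. 2 * q z t * qt z t)) (at t within {s..T})"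
  proof (rule leibniz_rule_field_derivative)
    show "((\<lambda>t. (q z t)\<^sup>2) has_real_derivative 2 * q z t * qt z t) (at t within {s..T})"
      if "t \<in> {s..T}" "z \<in> cbox a b" for t z
      using dqt[of z t] that by (auto intro!: derivative_eq_intros)
    show "(\<lambda>z. (q z t)\<^sup>2) integrable_on cbox a b" if "t \<in> {s..T}" for t
      using that by (auto intro!: integrable_continuous_real continuous_intros continuous_on_slice_fst[OF q])
    have "continuous_on ({a..b} \<times> {s..T}) (\<lambda>(z, t). 2 * q z t * qt z t)"
      using q qt unfolding case_prod_beta by (intro continuous_intros)
    then show "continuous_on ({s..T} \<times> cbox a b) (\<lambda>(t, z). 2 * q z t * qt z t)"
      by (auto dest: continuous_on_swap_args)
  qed (use t in auto)
  with eq show ?thesis by simp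
qed

text \<open>After integration by parts \<open>qt\<close> has disappeared from the derivative of the
  truncated energy. What remains is continuous up to the lateral boundary, so these derivatives
  converge uniformly on \<open>{s..T}\<close> as the truncation is removed.\<close>

lemma energy_identity:
  fixes q v \<phi> qt :: "real \<Rightarrow> real \<Rightarrow> real"
  assumes "l < r"
    and q: "continuous_on ({l..r} \<times> {s..T}) (\<lambda>(z, t). q z t)"
    and v: "continuous_on ({l..r} \<times> {s..T}) (\<lambda>(z, t). v z t)"
    and \<phi>: "continuous_on ({l..r} \<times> {s..T}) (\<lambda>(z, t). \<phi> z t)"
    and qt: "continuous_on ({l<..<r} \<times> {s..T}) (\<lambda>(z, t). qt z t)"
    and dqz: "\<And>z t. z \<in> {l<..<r} \<Longrightarrow> t \<in> {s..T} \<Longrightarrow> ((\<lambda>y. q y t) has_real_derivative v z t) (at z)"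
    and d\<phi>: "\<And>z t. z \<in> {l<..<r} \<Longrightarrow> t \<in> {s..T} \<Longrightarrow> ((\<lambda>y. \<phi> y t) has_real_derivative qt z t) (at z)"
    and dqt: "\<And>z t. z \<in> {l<..<r} \<Longrightarrow> t \<in> {s..T} \<Longrightarrow>
      ((\<lambda>u. q z u) has_real_derivative qt z t) (at t within {s..T})"
    and t: "t \<in> {s..T}"
  shows "((\<lambda>t. integral {l..r} (\<lambda>z. (q z t)\<^sup>2)) has_real_derivative
    2 * (q r t * \<phi> r t - q l t * \<phi> l t - integral {l..r} (\<lambda>z. v z t * \<phi> z t))) (at t within {s..T})"
proof -
  \<comment> \<open>The factor 1/2 keeps the cut points in order: at \<open>n = 0\<close> both sit
    at the midpoint, and later intervals grow towards \<open>{l..r}\<close>.\<close>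
  define d where "d n = (r - l) / 2 * inverse (real (Suc n))" for n
  define a where "a n = l + d n" for n
  define b where "b n = r - d n" for n
  have "d \<longlonglongrightarrow> (r - l) / 2 * 0"
    unfolding d_def by (intro tendsto_intros LIMSEQ_inverse_real_of_nat)
  then have d: "d \<longlonglongrightarrow> 0" by simp
  have "a \<longlonglongrightarrow> l + 0" "b \<longlonglongrightarrow> r - 0"
    unfolding a_def b_def by (intro tendsto_intros d)+
  then have lim: "a \<longlonglongrightarrow> l" "b \<longlonglongrightarrow> r" by simp_all
  have "0 < d n" "d n \<le> (r - l) / 2 * 1" for n
    unfolding d_def using \<open>l < r\<close> by (simp, intro mult_left_mono) (auto simp: field_simps)
  then have bds: "l < a n" "b n < r" "a n \<le> b n" for n
    unfolding a_def b_def by (simp_all add: field_simps)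
  have sub: "{a n..b n} \<subseteq> {l<..<r}" "{a n..b n} \<subseteq> {l..r}" for n
    using bds[of n] by auto
  have in_lr: "a n \<in> {l..r}" "b n \<in> {l..r}" for n
    using bds[of n] by auto
  have P: "continuous_on ({l..r} \<times> {s..T}) (\<lambda>(z, t). q z t * \<phi> z t)"
    using q \<phi> unfolding case_prod_beta by (intro continuous_intros)
  have R: "continuous_on ({l..r} \<times> {s..T}) (\<lambda>(z, t). v z t * \<phi> z t)"
    using v \<phi> unfolding case_prod_beta by (intro continuous_intros)
  have Q: "continuous_on ({l..r} \<times> {s..T}) (\<lambda>(z, t). (q z t)\<^sup>2)"
    using q unfolding case_prod_beta by (intro continuous_intros)
  show ?thesis
  proof (rule has_real_derivative_uniform_limit[where S = "{s..T}"
        and f = "\<lambda>n t. integral {a n..b n} (\<lambda>z. (q z t)\<^sup>2)"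
        and f' = "\<lambda>n t. 2 * (q (b n) t * \<phi> (b n) t - q (a n) t * \<phi> (a n) t
            - integral {a n..b n} (\<lambda>z. v z t * \<phi> z t))"])
    show "((\<lambda>t. integral {a n..b n} (\<lambda>z. (q z t)\<^sup>2)) has_real_derivative
        2 * (q (b n) t * \<phi> (b n) t - q (a n) t * \<phi> (a n) t - integral {a n..b n} (\<lambda>z. v z t * \<phi> z t)))
        (at t within {s..T})" if "t \<in> {s..T}" for n t
    proof (rule energy_identity_interior[where qt = qt])
      show "((\<lambda>y. q y t) has_real_derivative v z t) (at z within {a n..b n})"
        "((\<lambda>y. \<phi> y t) has_real_derivative qt z t) (at z within {a n..b n})"
        "((\<lambda>u. q z u) has_real_derivative qt z t) (at t within {s..T})"
        if "z \<in> {a n..b n}" "t \<in> {s..T}" for z t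
        using sub(1)[of n] that
        by (auto intro!: has_field_derivative_at_within[OF dqz] has_field_derivative_at_within[OF d\<phi>] dqt)
    qed (use sub[of n] bds that in
        \<open>auto intro: continuous_on_subset[OF q] continuous_on_subset[OF v]
           continuous_on_subset[OF \<phi>] continuous_on_subset[OF qt]\<close>)
    have "uniform_limit {s..T} (\<lambda>n t. q (b n) t * \<phi> (b n) t) (\<lambda>t. q r t * \<phi> r t) sequentially"
      "uniform_limit {s..T} (\<lambda>n t. q (a n) t * \<phi> (a n) t) (\<lambda>t. q l t * \<phi> l t) sequentially"
      using in_lr \<open>l < r\<close> by (auto intro!: uniform_limit_slice[OF P] lim)
    moreover have "uniform_limit {s..T} (\<lambda>n t. integral {a n..b n} (\<lambda>z. v z t * \<phi> z t))
        (\<lambda>t. integral {l..r} (\<lambda>z. v z t * \<phi> z t)) sequentially"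
      using bds by (intro uniform_limit_shrinking_integral[OF R] lim) (auto intro: less_imp_le)
    ultimately show "uniform_limit {s..T}
        (\<lambda>n t. 2 * (q (b n) t * \<phi> (b n) t - q (a n) t * \<phi> (a n) t
            - integral {a n..b n} (\<lambda>z. v z t * \<phi> z t)))
        (\<lambda>t. 2 * (q r t * \<phi> r t - q l t * \<phi> l t - integral {l..r} (\<lambda>z. v z t * \<phi> z t))) sequentially"
      by (intro bounded_linear.uniform_limit[OF bounded_linear_mult_right] uniform_limit_minus)
    show "(\<lambda>n. integral {a n..b n} (\<lambda>z. (q z t)\<^sup>2)) \<longlonglongrightarrow> integral {l..r} (\<lambda>z. (q z t)\<^sup>2)"
      if "t \<in> {s..T}" for t
      using bds that
      by (intro tendsto_uniform_limitI[OF uniform_limit_shrinking_integral[OF Q]] lim) (auto intro: less_imp_le)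
  qed (use t in auto)
qed

section \<open>The differential inequality at a fixed time\<close>

text \<open>Dissipation provides at least \<open>2 * \<epsilon>\<close> times the integral of the
  squared gradient. One half pays for the convection term \<open>w * u * v\<close>, the other for
  the boundary value \<open>u 0\<close>.\<close>

lemma energy_estimate:
  fixes u v k w :: "real \<Rightarrow> real"
  assumes "h > 0" "\<epsilon> > 0"
    and du: "\<And>z. z \<in> {0..h} \<Longrightarrow> (u has_real_derivative v z) (at z within {0..h})"
    and cont: "continuous_on {0..h} v" "continuous_on {0..h} k" "continuous_on {0..h} w"
    and k: "\<And>z. z \<in> {0..h} \<Longrightarrow> \<epsilon> \<le> k z" and w: "\<And>z. z \<in> {0..h} \<Longrightarrow> \<bar>w z\<bar> \<le> W"
  shows "2 * (c * u 0 - integral {0..h} (\<lambda>z. v z * (k z * v z - w z * u z)))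
    \<le> (2 * \<epsilon> / h\<^sup>2 + W\<^sup>2 / \<epsilon>) * integral {0..h} (\<lambda>z. (u z)\<^sup>2) + h / \<epsilon> * c\<^sup>2"
proof -
  have cu: "continuous_on {0..h} u"
    using du by (rule DERIV_continuous_on)
  \<comment> \<open>The integrand is the derivative of \<open>(h - z) * (u z)\<^sup>2\<close>; the
    weight vanishes at \<open>h\<close>, which leaves only the value at 0.\<close>
  have trace: "((\<lambda>z. - (u z)\<^sup>2 + (h - z) * (2 * u z * v z)) has_integral
      (h - h) * (u h)\<^sup>2 - (h - 0) * (u 0)\<^sup>2) {0..h}"
    using du \<open>h > 0\<close>
    by (intro fundamental_theorem_of_calculus)
       (auto intro!: derivative_eq_intros simp: has_real_derivative_iff_has_vector_derivative[symmetric])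
  have flux: "((\<lambda>z. v z * (k z * v z - w z * u z)) has_integral
      integral {0..h} (\<lambda>z. v z * (k z * v z - w z * u z))) {0..h}"
    by (intro integrable_integral integrable_continuous_real continuous_intros cont cu)
  have energy: "((\<lambda>z. (u z)\<^sup>2) has_integral integral {0..h} (\<lambda>z. (u z)\<^sup>2)) {0..h}"
    by (intro integrable_integral integrable_continuous_real continuous_intros cu)
  \<comment> \<open>The multiplier \<open>- \<epsilon> / h\<^sup>2\<close> makes the gradient part
    of the trace identity cost exactly \<open>\<epsilon> * (v z)\<^sup>2\<close>. Integrated, it
    yields \<open>\<epsilon> / h * (u 0)\<^sup>2\<close> on the left.\<close>
  have pointwise: "(- \<epsilon> / h\<^sup>2) * (- (u z)\<^sup>2 + (h - z) * (2 * u z * v z)) + (- 2) * (v z * (k z * v z - w z * u z))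
      \<le> (2 * \<epsilon> / h\<^sup>2 + W\<^sup>2 / \<epsilon>) * (u z)\<^sup>2" if z: "z \<in> {0..h}" for z
  proof -
    have "- ((h - z) * (2 * u z * v z)) \<le> (u z)\<^sup>2 + h\<^sup>2 * (v z)\<^sup>2"
    proof -
      have "0 \<le> (u z + (h - z) * v z)\<^sup>2" by simp
      moreover have "((h - z) * v z)\<^sup>2 \<le> h\<^sup>2 * (v z)\<^sup>2"
        unfolding power_mult_distrib using z by (intro mult_right_mono power_mono) auto
      moreover have "(h - z) * (2 * u z * v z) = 2 * u z * ((h - z) * v z)" by simp
      ultimately show ?thesis unfolding power2_sum by linarith
    qed
    then have "\<epsilon> / h\<^sup>2 * ((u z)\<^sup>2 - (h - z) * (2 * u z * v z)) \<le> \<epsilon> / h\<^sup>2 * (2 * (u z)\<^sup>2 + h\<^sup>2 * (v z)\<^sup>2)"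
      using \<open>\<epsilon> > 0\<close> by (intro mult_left_mono) auto
    then have 1: "\<epsilon> / h\<^sup>2 * ((u z)\<^sup>2 - (h - z) * (2 * u z * v z)) \<le> 2 * \<epsilon> / h\<^sup>2 * (u z)\<^sup>2 + \<epsilon> * (v z)\<^sup>2"
      using \<open>h > 0\<close> by (simp add: field_simps)
    \<comment> \<open>Young's inequality for the convection term, weighted so that it uses the
      second \<open>\<epsilon> * (v z)\<^sup>2\<close>.\<close>
    have "0 \<le> (\<epsilon> * v z - w z * u z)\<^sup>2 / \<epsilon>"
      using \<open>\<epsilon> > 0\<close> by simp
    also have "\<dots> = \<epsilon> * (v z)\<^sup>2 - 2 * (v z * (w z * u z)) + (w z)\<^sup>2 / \<epsilon> * (u z)\<^sup>2"
      using \<open>\<epsilon> > 0\<close> by (simp add: power2_eq_square field_simps)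
    also have "(w z)\<^sup>2 / \<epsilon> * (u z)\<^sup>2 \<le> W\<^sup>2 / \<epsilon> * (u z)\<^sup>2"
      using w[OF z] \<open>\<epsilon> > 0\<close> by (intro mult_right_mono divide_right_mono) (auto simp: abs_le_square_iff[symmetric])
    finally have 2: "2 * (v z * (w z * u z)) \<le> \<epsilon> * (v z)\<^sup>2 + W\<^sup>2 / \<epsilon> * (u z)\<^sup>2" by simp
    have 3: "\<epsilon> * (v z)\<^sup>2 \<le> k z * (v z)\<^sup>2"
      using k[OF z] by (intro mult_right_mono) auto
    show ?thesis
      using 1 2 3 by (simp add: algebra_simps power2_eq_square)
  qed
  have "(- \<epsilon> / h\<^sup>2) * ((h - h) * (u h)\<^sup>2 - (h - 0) * (u 0)\<^sup>2)
      + (- 2) * integral {0..h} (\<lambda>z. v z * (k z * v z - w z * u z))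
      \<le> (2 * \<epsilon> / h\<^sup>2 + W\<^sup>2 / \<epsilon>) * integral {0..h} (\<lambda>z. (u z)\<^sup>2)"
    by (rule has_integral_le[OF has_integral_add[OF has_integral_mult_right[OF trace]
          has_integral_mult_right[OF flux]] has_integral_mult_right[OF energy] pointwise])
  moreover have "(- \<epsilon> / h\<^sup>2) * ((h - h) * (u h)\<^sup>2 - (h - 0) * (u 0)\<^sup>2) = \<epsilon> / h * (u 0)\<^sup>2"
    using \<open>h > 0\<close> by (simp add: power2_eq_square)
  moreover have "2 * (c * u 0) \<le> \<epsilon> / h * (u 0)\<^sup>2 + h / \<epsilon> * c\<^sup>2"
  proof -
    \<comment> \<open>Young's inequality again, with the weight that matches the boundary term
      gained from \<open>trace\<close>.\<close>
    have "0 \<le> (\<epsilon> * u 0 - h * c)\<^sup>2 / (\<epsilon> * h)"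
      using assms(1,2) by simp
    also have "\<dots> = \<epsilon> / h * (u 0)\<^sup>2 - 2 * (c * u 0) + h / \<epsilon> * c\<^sup>2"
      using assms(1,2) by (simp add: power2_eq_square field_simps)
    finally show ?thesis by simp
  qed
  ultimately show ?thesis by argo
qed

section \<open>Gronwall's argument\<close>

text \<open>The function \<open>H\<close> is nonincreasing. The derivative is asked for only at
  interior times, with continuity at the ends, because the energy of a classical solution need not
  be differentiable at time 0.\<close>

lemma gronwall_inequality:
  fixes E f :: "real \<Rightarrow> real"
  assumes E: "continuous_on {0..T} E" and f: "continuous_on {0..T} f"
    and "C \<ge> 0" and f0: "\<And>t. t \<in> {0..T} \<Longrightarrow> f t \<ge> 0"
    and dE: "\<And>t. 0 < t \<Longrightarrow> t < T \<Longrightarrow> \<exists>E'. (E has_real_derivative E') (at t) \<and> E' \<le> C * E t + f t"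
    and t: "t \<in> {0..T}"
  shows "E t \<le> exp (C * t) * (E 0 + integral {0..t} f)"
proof -
  define H where "H t = exp (- C * t) * E t - integral {0..t} f" for t
  have dI: "((\<lambda>t. integral {0..t} f) has_real_derivative f t) (at t within {0..T})" if "t \<in> {0..T}" for t
    by (rule integral_has_real_derivative[OF f that])
  have "continuous_on {0..T} (\<lambda>t. integral {0..t} f)"
    using dI by (rule DERIV_continuous_on)
  then have contH: "continuous_on {0..T} H"
    unfolding H_def by (intro continuous_intros E)
  have "H t \<le> H 0"
  proof (rule DERIV_nonpos_imp_decreasing_open[where f = H and a = 0 and b = t])
    fix x assume x: "0 < x" "x < t"
    with t have xT: "x < T" by simp
    then have "x \<in> {0..T}" "at x within {0..T} = at x"
      using x by (auto intro!: at_within_Icc_at)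
    with dI have dI': "((\<lambda>t. integral {0..t} f) has_real_derivative f x) (at x)" by metis
    from dE[OF x(1) xT] obtain E' where E': "(E has_real_derivative E') (at x)" "E' \<le> C * E x + f x"
      by blast
    have "(H has_real_derivative exp (- C * x) * (E' - C * E x) - f x) (at x)"
      unfolding H_def by (rule derivative_eq_intros E' dI' refl | simp add: algebra_simps)+
    moreover have "exp (- C * x) * (E' - C * E x) \<le> 1 * f x"
      using E'(2) f0[of x] x xT \<open>C \<ge> 0\<close>
      by (intro order_trans[OF mult_left_mono[of _ "f x"] mult_right_mono]) auto
    ultimately show "\<exists>y. (H has_real_derivative y) (at x) \<and> y \<le> 0" by fastforce
  qed (use t in \<open>auto intro: continuous_on_subset[OF contH]\<close>)
  then have "exp (- C * t) * E t \<le> E 0 + integral {0..t} f"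
    by (simp add: H_def)
  then have "exp (C * t) * (exp (- C * t) * E t) \<le> exp (C * t) * (E 0 + integral {0..t} f)"
    by (intro mult_left_mono) auto
  then show ?thesis
    by (simp add: mult.assoc[symmetric] exp_add[symmetric])
qed

section \<open>Norms and regularity classes from the definitions\<close>

lemma L2_norm_power2:
  assumes "continuous_on {a..b} f"
  shows "(L2_norm a b f)\<^sup>2 = integral {a..b} (\<lambda>x. (f x)\<^sup>2)"
proof -
  have c: "continuous_on {a..b} (\<lambda>x. (f x)\<^sup>2)"
    by (intro continuous_intros assms)
  then have "set_integrable lborel {a..b} (\<lambda>x. (f x)\<^sup>2)"
    by (rule borel_integrable_atLeastAtMost')
  then have "set_integrable lborel {a<..<b} (\<lambda>x. (f x)\<^sup>2)"
    by (rule set_integrable_subset) auto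
  then have "(LINT x:{a<..<b}|lborel. (f x)\<^sup>2) = integral {a..b} (\<lambda>x. (f x)\<^sup>2)"
    by (simp add: set_borel_integral_eq_integral integral_open_interval_real)
  moreover have "integral {a..b} (\<lambda>x. (f x)\<^sup>2) \<ge> 0"
    by (intro integral_nonneg integrable_continuous_real c) auto
  ultimately show ?thesis
    by (simp add: L2_norm_def)
qed

lemma Cn_on_imp_continuous_on: "Cn_on n S f \<Longrightarrow> continuous_on S f"
  by (cases n) (auto simp: continuous_on_eq_continuous_within intro: DERIV_continuous)

lemma Cn_on_differentiable_at:
  assumes "Cn_on (Suc n) S f" "z \<in> interior S"
  shows "f differentiable at z"
proof -
  from assms interior_subset obtain D where "(f has_real_derivative D) (at z within S)"
    by fastforce
  with assms(2) show ?thesis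
    by (auto simp: at_within_interior[OF assms(2)] real_differentiable_def)
qed

section \<open>Classical solutions and the final bound\<close>

lemma classical_solution_energy_estimate:
  assumes sol: "classical_solution h k w T F q0 q"
    and pos: "h > 0" "\<epsilon> > 0"
    and k: "Cn_on 2 {0..h} k" and w: "Cn_on 2 {0..h} w" and w0: "w 0 = 0" "w h = 0"
    and k_ge: "\<And>z. z \<in> {0..h} \<Longrightarrow> \<epsilon> \<le> k z" and w_le: "\<And>z. z \<in> {0..h} \<Longrightarrow> \<bar>w z\<bar> \<le> W"
    and t: "0 < t" "t < T"
  shows "\<exists>E'. ((\<lambda>t. integral {0..h} (\<lambda>z. (q z t)\<^sup>2)) has_real_derivative E') (at t) \<and>
    E' \<le> (2 * \<epsilon> / h\<^sup>2 + W\<^sup>2 / \<epsilon>) * integral {0..h} (\<lambda>z. (q z t)\<^sup>2) + h / \<epsilon> * (k 0 * F t)\<^sup>2"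
proof -
  from sol obtain qz qzz qt where q: "continuous_on ({0..h} \<times> {0..T}) (\<lambda>(z, t). q z t)"
    and dq: "\<And>z t. z \<in> {0..h} \<Longrightarrow> t \<in> {0<..T} \<Longrightarrow>
        ((\<lambda>y. q y t) has_real_derivative qz z t) (at z within {0..h})"
    and qz: "continuous_on ({0..h} \<times> {0<..T}) (\<lambda>(z, t). qz z t)"
    and dqz: "\<And>z t. z \<in> {0<..<h} \<Longrightarrow> t \<in> {0<..T} \<Longrightarrow>
        ((\<lambda>y. qz y t) has_real_derivative qzz z t) (at z)"
    and dqt: "\<And>z t. z \<in> {0<..<h} \<Longrightarrow> t \<in> {0<..T} \<Longrightarrow>
        ((\<lambda>s. q z s) has_real_derivative qt z t) (at t within {0..T})"
    and qt: "continuous_on ({0<..<h} \<times> {0<..T}) (\<lambda>(z, t). qt z t)"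
    and pde: "\<And>z t. z \<in> {0<..<h} \<Longrightarrow> t \<in> {0<..T} \<Longrightarrow>
        qt z t + deriv (\<lambda>y. w y * q y t) z = deriv (\<lambda>y. k y * qz y t) z"
    and bc: "\<And>t. t \<in> {0<..T} \<Longrightarrow> qz 0 t = - F t" "\<And>t. t \<in> {0<..T} \<Longrightarrow> qz h t = 0"
    unfolding classical_solution_def by (elim conjE exE) blast
  \<comment> \<open>The flux: the equation says that its space derivative is
    \<open>qt\<close>.\<close>
  define \<phi> where "\<phi> z t = k z * qz z t - w z * q z t" for z t
  have ck: "continuous_on {0..h} k" and cw: "continuous_on {0..h} w"
    using k w by (auto dest: Cn_on_imp_continuous_on)
  \<comment> \<open>Any time strictly between 0 and \<open>t\<close> works: \<open>{s..T}\<close>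
    avoids time 0, where \<open>qz\<close> need not be continuous, and has \<open>t\<close> in its
    interior, so the derivative is two-sided.\<close>
  define s where "s = t / 2"
  have s: "0 < s" "s < t" using t by (auto simp: s_def)
  have cq: "continuous_on ({0..h} \<times> {s..T}) (\<lambda>(z, t). q z t)"
    by (rule continuous_on_subset[OF q]) (use s in auto)
  have cqz: "continuous_on ({0..h} \<times> {s..T}) (\<lambda>(z, t). qz z t)"
    by (rule continuous_on_subset[OF qz]) (use s in auto)
  have cqt: "continuous_on ({0<..<h} \<times> {s..T}) (\<lambda>(z, t). qt z t)"
    by (rule continuous_on_subset[OF qt]) (use s in auto)
  have c\<phi>: "continuous_on ({0..h} \<times> {s..T}) (\<lambda>(z, t). \<phi> z t)"
    using cq cqz unfolding \<phi>_def case_prod_beta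
    by (intro continuous_intros continuous_on_compose2[OF ck] continuous_on_compose2[OF cw]) auto
  have dq': "((\<lambda>y. q y t) has_real_derivative qz z t) (at z)" if "z \<in> {0<..<h}" "t \<in> {0<..T}" for z t
    using dq[of z t] that by (simp add: at_within_Icc_at)
  have d\<phi>: "((\<lambda>y. \<phi> y t) has_real_derivative qt z t) (at z)" if zt: "z \<in> {0<..<h}" "t \<in> {0<..T}" for z t
  proof -
    \<comment> \<open>The equation is phrased with the total operator \<open>deriv\<close>; only
      differentiability of both products turns it into a statement about actual derivatives.\<close>
    have "k differentiable at z" "w differentiable at z"
      using k w zt by (auto simp: numeral_2_eq_2 simp del: Cn_on.simps intro!: Cn_on_differentiable_at)
    moreover have "(\<lambda>y. q y t) differentiable at z" "(\<lambda>y. qz y t) differentiable at z"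
      using dq'[OF zt] dqz[OF zt] real_differentiable_def by blast+
    ultimately have d: "((\<lambda>y. w y * q y t) has_real_derivative deriv (\<lambda>y. w y * q y t) z) (at z)"
      "((\<lambda>y. k y * qz y t) has_real_derivative deriv (\<lambda>y. k y * qz y t) z) (at z)"
      by (auto simp: DERIV_deriv_iff_real_differentiable)
    have eq: "qt z t = deriv (\<lambda>y. k y * qz y t) z - deriv (\<lambda>y. w y * q y t) z"
      using pde[OF zt] by linarith
    show ?thesis
      unfolding \<phi>_def eq by (intro DERIV_diff d)
  qed
  have "((\<lambda>t. integral {0..h} (\<lambda>z. (q z t)\<^sup>2)) has_real_derivative
      2 * (q h t * \<phi> h t - q 0 t * \<phi> 0 t - integral {0..h} (\<lambda>z. qz z t * \<phi> z t))) (at t within {s..T})"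
  proof (rule energy_identity[OF pos(1) cq cqz c\<phi> cqt])
    show "((\<lambda>u. q z u) has_real_derivative qt z t) (at t within {s..T})"
      if "z \<in> {0<..<h}" "t \<in> {s..T}" for z t
      using dqt[of z t] that s by (auto intro: DERIV_subset)
  qed (use s t dq' d\<phi> in auto)
  moreover have "at t within {s..T} = at t"
    using s t by (intro at_within_Icc_at) auto
  \<comment> \<open>As \<open>w\<close> vanishes at both ends, the flux there is purely diffusive:
    zero at \<open>h\<close> and \<open>- k 0 * F t\<close> at 0.\<close>
  moreover have "q h t * \<phi> h t - q 0 t * \<phi> 0 t = (k 0 * F t) * q 0 t"
    using bc[of t] t w0 by (simp add: \<phi>_def)
  ultimately have "((\<lambda>t. integral {0..h} (\<lambda>z. (q z t)\<^sup>2)) has_real_derivative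
      2 * ((k 0 * F t) * q 0 t - integral {0..h} (\<lambda>z. qz z t * \<phi> z t))) (at t)"
    by (simp only:)
  moreover have "2 * ((k 0 * F t) * q 0 t - integral {0..h} (\<lambda>z. qz z t * \<phi> z t))
      \<le> (2 * \<epsilon> / h\<^sup>2 + W\<^sup>2 / \<epsilon>) * integral {0..h} (\<lambda>z. (q z t)\<^sup>2) + h / \<epsilon> * (k 0 * F t)\<^sup>2"
    unfolding \<phi>_def using t
    by (intro energy_estimate pos dq ck cw k_ge w_le continuous_on_slice_fst[OF qz]) auto
  ultimately show ?thesis by blast
qed

text \<open>Fixing \<open>W\<close> and \<open>k0\<close> before \<open>K\<close>, and quantifying
  over \<open>k\<close> and \<open>w\<close> after it, expresses that \<open>K\<close> depends on
  the coefficients only through these two numbers, besides \<open>\<epsilon>\<close> and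
  \<open>h\<close>.\<close>

theorem proposition2:
  fixes h \<epsilon> W k0 :: real
  assumes "h > 0" and "\<epsilon> > 0"
  shows "\<exists>K>0. \<forall>k w :: real \<Rightarrow> real.
    Cn_on 2 {0..h} k \<and> Cn_on 2 {0..h} w \<and>
    (\<forall>z\<in>{0..h}. k z > 0) \<and> w 0 = 0 \<and> w h = 0 \<and>
    (\<forall>z\<in>{0..h}. k z \<ge> \<epsilon>) \<and>
    (SUP z\<in>{0..h}. \<bar>w z\<bar>) = W \<and> k 0 = k0 \<longrightarrow>
    (\<forall>T>0. \<forall>F q0 q.
       continuous_on {0..T} F \<and> Cn_on 1 {0..h} q0 \<and> classical_solution h k w T F q0 q \<longrightarrow>
       (\<forall>t\<in>{0..T}.
          (L2_norm 0 h (\<lambda>z. q z t))\<^sup>2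
            \<le> K * exp (K * t) *
               ((1 + t) * (L2_norm 0 h q0)\<^sup>2 + (1 + t\<^sup>2) * (L2_norm 0 t F)\<^sup>2)))"
proof -
  define C where "C = 2 * \<epsilon> / h\<^sup>2 + W\<^sup>2 / \<epsilon>"
  define D where "D = h / \<epsilon> * k0\<^sup>2"
  \<comment> \<open>\<open>K\<close> must dominate the Gronwall rate \<open>C\<close>, the
    coefficient 1 of the initial energy and the coefficient \<open>D\<close> of the boundary
    data.\<close>
  define K where "K = 1 + C + D"
  have "C \<ge> 0" "D \<ge> 0"
    using assms by (auto simp: C_def D_def)
  then have K: "K > 0" "1 \<le> K" "C \<le> K" "D \<le> K"
    by (auto simp: K_def)
  have "(L2_norm 0 h (\<lambda>z. q z t))\<^sup>2
      \<le> K * exp (K * t) * ((1 + t) * (L2_norm 0 h q0)\<^sup>2 + (1 + t\<^sup>2) * (L2_norm 0 t F)\<^sup>2)"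
    if k: "Cn_on 2 {0..h} k" and w: "Cn_on 2 {0..h} w" and w0: "w 0 = 0" "w h = 0"
      and k_ge: "\<forall>z\<in>{0..h}. \<epsilon> \<le> k z" and W: "(SUP z\<in>{0..h}. \<bar>w z\<bar>) = W" and k0: "k 0 = k0"
      and F: "continuous_on {0..T} F" and q0: "Cn_on 1 {0..h} q0"
      and sol: "classical_solution h k w T F q0 q" and t: "t \<in> {0..T}"
    for k w F q0 q T t
  proof -
    define E where "E t = integral {0..h} (\<lambda>z. (q z t)\<^sup>2)" for t
    \<comment> \<open>A real \<open>SUP\<close> is known to bound its family only if that family is
      bounded above, which compactness ensures.\<close>
    have "continuous_on {0..h} w"
      using w by (rule Cn_on_imp_continuous_on)
    then have "compact ((\<lambda>z. \<bar>w z\<bar>) ` {0..h})"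
      by (intro compact_continuous_image continuous_intros) auto
    then have "bdd_above ((\<lambda>z. \<bar>w z\<bar>) ` {0..h})"
      by (intro bounded_imp_bdd_above compact_imp_bounded)
    then have w_le: "\<bar>w z\<bar> \<le> W" if "z \<in> {0..h}" for z
      unfolding W[symmetric] using that by (intro cSUP_upper)
    have q: "continuous_on ({0..h} \<times> {0..T}) (\<lambda>(z, t). q z t)"
      and init: "\<And>z. z \<in> {0..h} \<Longrightarrow> q z 0 = q0 z"
      using sol by (auto simp: classical_solution_def)
    have "continuous_on ({0..h} \<times> {0..T}) (\<lambda>(z, t). (q z t)\<^sup>2)"
      using q unfolding case_prod_beta by (intro continuous_intros)
    then have "continuous_on {0..T} (\<lambda>t. integral (cbox 0 h) (\<lambda>z. (q z t)\<^sup>2))"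
      by (intro integral_continuous_on_param) (auto dest: continuous_on_swap_args)
    then have contE: "continuous_on {0..T} E"
      by (simp add: E_def[abs_def])
    have "E t \<le> exp (C * t) * (E 0 + integral {0..t} (\<lambda>t. D * (F t)\<^sup>2))"
    proof (rule gronwall_inequality[OF contE _ \<open>C \<ge> 0\<close> _ _ t])
      show "\<exists>E'. (E has_real_derivative E') (at t) \<and> E' \<le> C * E t + D * (F t)\<^sup>2"
        if "0 < t" "t < T" for t
        using classical_solution_energy_estimate[OF sol assms k w w0 _ w_le that] k_ge k0
        by (simp add: E_def[abs_def] C_def D_def power_mult_distrib mult.assoc)
    qed (use \<open>D \<ge> 0\<close> in \<open>auto intro!: continuous_intros F\<close>)
    moreover have "E t = (L2_norm 0 h (\<lambda>z. q z t))\<^sup>2"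
      unfolding E_def by (intro L2_norm_power2[symmetric] continuous_on_slice_fst[OF q _ t]) auto
    moreover have "E 0 = (L2_norm 0 h q0)\<^sup>2"
    proof -
      have "E 0 = integral {0..h} (\<lambda>z. (q0 z)\<^sup>2)"
        unfolding E_def by (rule integral_cong) (simp add: init)
      then show ?thesis
        by (simp add: L2_norm_power2 Cn_on_imp_continuous_on[OF q0])
    qed
    moreover have "integral {0..t} (\<lambda>t. D * (F t)\<^sup>2) = D * (L2_norm 0 t F)\<^sup>2"
      using t by (subst L2_norm_power2) (auto intro: continuous_on_subset[OF F])
    ultimately have "(L2_norm 0 h (\<lambda>z. q z t))\<^sup>2 \<le> exp (C * t) * ((L2_norm 0 h q0)\<^sup>2 + D * (L2_norm 0 t F)\<^sup>2)"
      by metis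
    also have "\<dots> \<le> exp (K * t) * (K * ((1 + t) * (L2_norm 0 h q0)\<^sup>2) + K * ((1 + t\<^sup>2) * (L2_norm 0 t F)\<^sup>2))"
    proof (rule mult_mono)
      \<comment> \<open>The explicit factors 1 line up with \<open>K\<close> and with the polynomial
        weights in \<open>t\<close>, each at least 1, so \<open>mult_mono\<close> compares factor by
        factor.\<close>
      have "1 * (1 * (L2_norm 0 h q0)\<^sup>2) \<le> K * ((1 + t) * (L2_norm 0 h q0)\<^sup>2)"
        "D * (1 * (L2_norm 0 t F)\<^sup>2) \<le> K * ((1 + t\<^sup>2) * (L2_norm 0 t F)\<^sup>2)"
        by (intro mult_mono; use K t in simp)+
      then show "(L2_norm 0 h q0)\<^sup>2 + D * (L2_norm 0 t F)\<^sup>2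
          \<le> K * ((1 + t) * (L2_norm 0 h q0)\<^sup>2) + K * ((1 + t\<^sup>2) * (L2_norm 0 t F)\<^sup>2)"
        by simp
    qed (use K \<open>D \<ge> 0\<close> t in \<open>auto intro: mult_right_mono\<close>)
    finally show ?thesis
      by (simp add: algebra_simps)
  qed
  with K(1) show ?thesis by blast
qed

end
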